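(* For every integer $b \ge 2$ and every integer $k \ge 1$, $$L(b,k) = \frac{b(b-1)}{2b-1}\,(2b-1)^k - \frac{b-1}{2}\, b^k .$$
   Context: Let $b \ge 2$ be an integer. For a positive integer $n$, take the base-$b$ representation of $n$ (without leading zeros) and split it into its maximal runs of consecutive identical digits. Define $r(b,n)$ to be the nonnegative integer whose base-$b$ representation is obtained by shortening each run by one digit (so runs of length one disappear) and concatenating what remains in order; the resulting string may have leading zeros, and the empty string represents $0$. For example, $r(2,12)=2$, since $12$ is $1100$ in base $2$ and shortening each run gives $10$. For an integer $k\ge 1$ define $$L(b,k) = \sum_{n=b^k}^{b^{k+1}-1} r(b,n),$$ the sum of $r(b,n)$ over all $n$ whose base-$b$ representation has exactly $k+1$ digits. *)

theory Defs
  imports Complex_Main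
begin

text \<open>
  Digits are listed most significant first, without leading zeros; 0 gets the empty list.
  The guard \<open>b < 2\<close> only serves termination.
\<close>
function digits :: "nat \<Rightarrow> nat \<Rightarrow> nat list" where
  "digits b n = (if b < 2 \<or> n = 0 then [] else digits b (n div b) @ [n mod b])"
  by pat_completeness auto
termination
  by (relation "measure snd") auto

declare digits.simps [simp del]

text \<open>
  \<^const>\<open>horner_sum\<close> expects the least significant digit first, hence the reversal. Leading
  zeros are harmless and the empty list denotes 0.
\<close>
definition from_digits :: "nat \<Rightarrow> nat list \<Rightarrow> nat" where
  "from_digits b ds = horner_sum id b (rev ds)"

text \<open>The list of the maximal blocks of consecutive equal entries, in order.\<close>
function runs :: "'a list \<Rightarrow> 'a list list" where
  "runs [] = []"
| "runs (x # xs) = (x # takeWhile (\<lambda>y. y = x) xs) # runs (dropWhile (\<lambda>y. y = x) xs)"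
  by pat_completeness auto
termination
  by (relation "measure length") (auto simp: le_imp_less_Suc length_dropWhile_le)

definition r :: "nat \<Rightarrow> nat \<Rightarrow> nat" where
  "r b n = from_digits b (concat (map tl (runs (digits b n))))"

definition L :: "nat \<Rightarrow> nat \<Rightarrow> nat" where
  "L b k = (\<Sum>n = b ^ k..b ^ (k + 1) - 1. r b n)"

lemma from_digits_digits: "b \<ge> 2 \<Longrightarrow> from_digits b (digits b n) = n"
proof (induction b n rule: digits.induct)
  case (1 b n)
  show ?case
  proof (cases "n = 0")
    case True
    then show ?thesis by (simp add: digits.simps from_digits_def)
  next
    case False
    then have "digits b n = digits b (n div b) @ [n mod b]"
      using 1(2) by (subst digits.simps) simp
    with 1 False show ?thesis by (simp add: from_digits_def)
  qed
qed

lemma digits_12: "digits 2 12 = [1, 1, 0, 0]"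
  by (simp add: digits.simps)

lemma r_2_12: "r 2 12 = 2"
  by (simp add: r_def digits_12 from_digits_def)

end

theory Submission
  imports Defs
begin

text \<open>
  The proof is a recurrence in the number of digits. Appending a digit \<open>e\<close> to the representation
  of \<open>n \<ge> 1\<close> either opens a new run of length one, which disappears, or prolongs the last run,
  in which case \<open>e\<close> is also appended to the shortened string. Hence \<open>r b (n * b + e)\<close> is \<open>r b n\<close>
  for the \<open>b - 1\<close> digits \<open>e\<close> that differ from \<open>n mod b\<close>, and \<open>b * r b n + e\<close> for the remaining
  one (\<open>r_append_digit\<close>). Summing over \<open>e\<close> gives \<open>(2 * b - 1) * r b n + n mod b\<close>, and summing
  over all \<open>n\<close> with \<open>k + 1\<close> digits gives \<open>L b (k + 1) = (2 * b - 1) * L b k + S k\<close> (\<open>L_Suc\<close>),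
  where \<open>S k\<close> is the sum of the last digits of these \<open>n\<close>.

  For \<open>k = 0\<close> the only digit is also the leading one; excluding 0 does not change the sum of the
  digits, so \<open>S 0 = b * (b - 1) / 2\<close>. For \<open>k \<ge> 1\<close> the last digit is independent of the digits
  before it, which gives \<open>S k = (b - 1)\<^sup>2 * b ^ k / 2\<close> (\<open>sum_last_digits\<close>). Since \<open>S 0\<close> does not
  follow this pattern, the induction for the closed form starts at \<open>L b 1 = S 0\<close>.
\<close>

text \<open>
  Shortening all runs keeps exactly the entries that equal their right neighbour; this turns the
  recursion over whole runs into one over single entries.
\<close>
lemma shortened_runs_Cons_Cons:
  "concat (map tl (runs (x # y # zs))) =
     (if x = y then [x] else []) @ concat (map tl (runs (y # zs)))"
  by auto

lemma shortened_runs_snoc: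
  assumes "xs \<noteq> []"
  shows "concat (map tl (runs (xs @ [e]))) =
    concat (map tl (runs xs)) @ (if last xs = e then [e] else [])"
  using assms
proof (induction xs)
  case Nil
  then show ?case by simp
next
  case (Cons x xs)
  show ?case
  proof (cases xs)
    case Nil
    then show ?thesis by simp
  next
    case (Cons y zs)
    with Cons.IH show ?thesis
      by (simp add: shortened_runs_Cons_Cons del: runs.simps)
  qed
qed

lemma digits_append:
  assumes "n \<ge> 1" and "e < b" and "b \<ge> 2"
  shows "digits b (n * b + e) = digits b n @ [e]"
  using assms by (simp add: digits.simps[of b "n * b + e"])

lemma digits_nonempty_last:
  assumes "n \<ge> 1" and "b \<ge> 2"
  shows "digits b n \<noteq> []" and "last (digits b n) = n mod b"
  using assms by (simp_all add: digits.simps[of b n])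

lemma r_append_digit:
  assumes "n \<ge> 1" and "e < b" and "b \<ge> 2"
  shows "r b (n * b + e) = (if n mod b = e then b * r b n + e else r b n)"
  using assms
  by (simp add: r_def digits_append digits_nonempty_last shortened_runs_snoc from_digits_def)

lemma sum_r_append_digit:
  assumes "n \<ge> 1" and "b \<ge> 2"
  shows "(\<Sum>e<b. real (r b (n * b + e))) = (2 * real b - 1) * real (r b n) + real (n mod b)"
proof -
  have "(\<Sum>e<b. real (r b (n * b + e))) =
      (\<Sum>e<b. real (r b n) + (if e = n mod b then (real b - 1) * real (r b n) + real e else 0))"
  proof (intro sum.cong refl)
    fix e assume "e \<in> {..<b}"
    then have "r b (n * b + e) = (if n mod b = e then b * r b n + e else r b n)"
      using assms by (simp add: r_append_digit)
    then show "real (r b (n * b + e)) =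
        real (r b n) + (if e = n mod b then (real b - 1) * real (r b n) + real e else 0)"
      by (auto simp: left_diff_distrib)
  qed
  also have "\<dots> = real b * real (r b n) + ((real b - 1) * real (r b n) + real (n mod b))"
    using assms by (simp add: sum.distrib sum.delta)
  finally show ?thesis
    by (simp add: algebra_simps)
qed

lemma sum_by_last_digit:
  fixes f :: "nat \<Rightarrow> real"
  assumes "m \<le> n"
  shows "sum f {m * b..<n * b} = (\<Sum>i = m..<n. \<Sum>e<b. f (i * b + e))"
  using assms
proof (induction n rule: dec_induct)
  case base
  then show ?case by simp
next
  case (step n)
  have "sum f {m * b..<Suc n * b} = sum f {m * b..<n * b} + sum f {n * b..<Suc n * b}"
    using step.hyps by (intro sum.atLeastLessThan_concat[symmetric]) auto
  also have "sum f {n * b..<Suc n * b} = (\<Sum>e<b. f (n * b + e))"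
    using sum.shift_bounds_nat_ivl[of f 0 "n * b" b] by (simp add: atLeast0LessThan add.commute)
  finally show ?case
    using step by simp
qed

lemma L_half_open:
  assumes "b \<ge> 2"
  shows "real (L b k) = (\<Sum>n = b ^ k..<b ^ Suc k. real (r b n))"
proof -
  have "0 < b ^ (k + 1)"
    using assms by simp
  then have "{b ^ k..b ^ (k + 1) - 1} = {b ^ k..<b ^ (k + 1)}"
    by (metis One_nat_def Suc_pred atLeastLessThanSuc_atLeastAtMost)
  then show ?thesis
    by (simp add: L_def)
qed

lemma L_Suc:
  assumes "b \<ge> 2"
  shows "real (L b (Suc k)) =
    (2 * real b - 1) * real (L b k) + (\<Sum>n = b ^ k..<b ^ Suc k. real (n mod b))"
proof -
  have le: "b ^ k \<le> b ^ Suc k" and pos: "b ^ k \<ge> 1"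
    using assms by simp_all
  have "real (L b (Suc k)) = (\<Sum>n = b ^ k..<b ^ Suc k. \<Sum>e<b. real (r b (n * b + e)))"
    using sum_by_last_digit[OF le, of "\<lambda>n. real (r b n)" b] L_half_open[OF assms, of "Suc k"]
    by (simp add: mult.commute)
  also have "\<dots> = (\<Sum>n = b ^ k..<b ^ Suc k. (2 * real b - 1) * real (r b n) + real (n mod b))"
    using assms le_trans[OF pos] by (intro sum.cong refl sum_r_append_digit) auto
  finally show ?thesis
    by (simp only: L_half_open[OF assms] sum.distrib sum_distrib_left)
qed

lemma sum_all_digits: "(\<Sum>e<b. real e) = real b * (real b - 1) / 2"
  by (induction b) (auto simp: field_simps)

lemma sum_last_digits:
  assumes "b \<ge> 2"
  shows "(\<Sum>n = b ^ Suc k..<b ^ Suc (Suc k). real (n mod b)) =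
    (real b - 1)\<^sup>2 / 2 * real b ^ Suc k"
proof -
  have le: "b ^ k \<le> b ^ Suc k"
    using assms by simp
  have "(\<Sum>n = b ^ Suc k..<b ^ Suc (Suc k). real (n mod b)) =
      (\<Sum>n = b ^ k..<b ^ Suc k. \<Sum>e<b. real ((n * b + e) mod b))"
    using sum_by_last_digit[OF le, of "\<lambda>n. real (n mod b)" b] by (simp add: mult.commute)
  also have "\<dots> = (\<Sum>n = b ^ k..<b ^ Suc k. \<Sum>e<b. real e)"
    by (intro sum.cong) auto
  also have "\<dots> = (real b ^ Suc k - real b ^ k) * (real b * (real b - 1) / 2)"
    using le by (simp add: sum_all_digits of_nat_diff)
  finally show ?thesis
    by (simp add: power2_eq_square field_simps)
qed

lemma L_0:
  assumes "b \<ge> 2"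
  shows "L b 0 = 0"
proof -
  have "r b n = 0" if "n \<in> {b ^ 0..b ^ (0 + 1) - 1}" for n
  proof -
    have "1 \<le> n" and "n < b"
      using that assms by auto
    then have "digits b n = [n]"
      using assms by (simp add: digits.simps[of b n] digits.simps[of b 0])
    then show ?thesis
      by (simp add: r_def from_digits_def)
  qed
  then show ?thesis
    by (simp add: L_def)
qed

lemma L_1:
  assumes "b \<ge> 2"
  shows "real (L b 1) = real b * (real b - 1) / 2"
proof -
  have "real (L b 1) = (\<Sum>n = 1..<b. real (n mod b))"
    using L_Suc[OF assms, of 0] L_0[OF assms] by simp
  also have "\<dots> = (\<Sum>n = 1..<b. real n)"
    by (intro sum.cong) auto
  also have "\<dots> = (\<Sum>n<b. real n)"
    by (intro sum.mono_neutral_left) auto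
  finally show ?thesis
    by (simp add: sum_all_digits)
qed

theorem corollary2p2:
  fixes b k :: nat
  assumes "b \<ge> 2" and "k \<ge> 1"
  shows "real (L b k) =
    real b * (real b - 1) / (2 * real b - 1) * (2 * real b - 1) ^ k
      - (real b - 1) / 2 * real b ^ k"
  using assms(2)
proof (induction k rule: dec_induct)
  case base
  have "2 * real b - 1 \<noteq> 0"
    using assms(1) by linarith
  then have "real b * (real b - 1) / (2 * real b - 1) * (2 * real b - 1) ^ 1
      - (real b - 1) / 2 * real b ^ 1 = real b * (real b - 1) - (real b - 1) / 2 * real b"
    by simp
  also have "\<dots> = real b * (real b - 1) / 2"
    by (simp add: field_simps)
  finally show ?case
    using L_1[OF assms(1)] by simp
next
  case (step k)
  then obtain j where k: "k = Suc j"
    by (cases k) auto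
  define c where "c = real b * (real b - 1) / (2 * real b - 1)"
  have "real (L b (Suc k)) =
      (2 * real b - 1) * (c * (2 * real b - 1) ^ k - (real b - 1) / 2 * real b ^ k)
        + (real b - 1)\<^sup>2 / 2 * real b ^ k"
    using L_Suc[OF assms(1), of k] step.IH sum_last_digits[OF assms(1), of j]
    unfolding k c_def by simp
  also have "\<dots> = c * (2 * real b - 1) ^ Suc k - (real b - 1) / 2 * real b ^ Suc k"
    by (simp add: power2_eq_square algebra_simps add_divide_distrib diff_divide_distrib)
  finally show ?case
    unfolding c_def .
qed

end
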